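(* Let $\mathcal{B}$ and $\mathcal{C}$ be two barcodes of finite bounded type, and let $\Lambda_{\mathcal{B}}=\{\lambda_i\}_{i=1}^{\infty}$ and $\Lambda_{\mathcal{C}}=\{\mu_j\}_{j=1}^{\infty}$ be their sequences of eigenvalues, arranged so that $\lambda_1\ge\lambda_2\ge\cdots$ and $\mu_1\ge\mu_2\ge\cdots$. Then $$d_{S}^{(2)}(\mathcal{B},\mathcal{C})=\inf_{\sigma}\sqrt{\sum_{i=1}^{\infty}|\lambda_i-\mu_{\sigma(i)}|^{2}}=\sqrt{\sum_{i=1}^{\infty}|\lambda_i-\mu_i|^{2}},$$ where $\sigma$ ranges over all bijections $\mathbb{N}\to\mathbb{N}$.
   Context: A barcode of finite bounded type is a (nonempty) finite multiset $\mathcal{B}=\{I_i\}_{i=1}^{n}$ of bounded intervals $I_i=(a_i,b_i]$ with $a_i<b_i$ real; an interval may appear multiple times. Gram matrix: let $f_i$ be the characteristic function of $I_i=(a_i,b_i]$ on $\mathbb{R}$. The Gram matrix of $\mathcal{B}$ is the $n\times n$ matrix $G_{\mathcal{B}}=(\langle f_i,f_j\rangle)_{i,j=1}^{n}$ with $\langle f_i,f_j\rangle=\int_{\mathbb{R}}\overline{f_j(x)}f_i(x)\,dx=\int_{(a_i,b_i]\cap(a_j,b_j]}1\,dx$. It is positive semi-definite with non-negative entries. Let $\|G_{\mathcal{B}}\|$ be its operator norm, and let $\widetilde{G}_{\mathcal{B}}=\frac{G_{\mathcal{B}}}{\|G_{\mathcal{B}}\|}\oplus\mathbf{0}$, where $\mathbf{0}$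 is the zero operator on an infinite-dimensional space; so $\widetilde{G}_{\mathcal{B}}$ is the infinite matrix (indexed by $\mathbb{N}=\{1,2,\dots\}$) with upper-left $n\times n$ block $G_{\mathcal{B}}/\|G_{\mathcal{B}}\|$ and all other entries zero. Eigenvalue sequence: $\Lambda_{\mathcal{B}}=\{\lambda_i\}_{i=1}^{\infty}$ denotes the sequence of eigenvalues of $\widetilde{G}_{\mathcal{B}}$ listed with multiplicity, i.e. the $n$ eigenvalues of $G_{\mathcal{B}}/\|G_{\mathcal{B}}\|$ (with multiplicity) together with infinitely many zeros. All are non-negative and only finitely many are nonzero. Pseudo-distance: for barcodes $\mathcal{B},\mathcal{C}$ of finite bounded type with eigenvalue sequences $\{\lambda_i\}$ and $\{\mu_j\}$ (in any order), $d_{S}^{(2)}(\mathcal{B},\mathcal{C})=\inf_{\sigma}\sqrt{\sum_{i=1}^{\infty}|\lambda_i-\mu_{\sigma(i)}|^{2}}$, where $\sigma$ ranges over all bijections $\sigma:\mathbb{N}\to\mathbb{N}$. *)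

theory Defs
  imports
    "HOL-Analysis.Analysis"
    "HOL-Library.Multiset"
    "Jordan_Normal_Form.Char_Poly"
begin

type_synonym barcode = "real set multiset"

definition finite_bounded_type :: "barcode \<Rightarrow> bool" where
  "finite_bounded_type B \<longleftrightarrow>
     B \<noteq> {#} \<and> (\<forall>I \<in># B. \<exists>a b. a < b \<and> I = {a<..b})"

text \<open>The matrices depend on an enumeration \<open>Is\<close> of the multiset. The characteristic functions
  are real-valued, so no complex conjugate appears in the inner product.\<close>

definition gram_matrix :: "real set list \<Rightarrow> real mat" where
  "gram_matrix Is = mat (length Is) (length Is)
     (\<lambda>(i, j). LINT x|lborel. indicator (Is ! j) x * indicator (Is ! i) x)"

definition euclidean_norm :: "real vec \<Rightarrow> real" where
  "euclidean_norm v = sqrt (v \<bullet> v)"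

definition operator_norm :: "real mat \<Rightarrow> real" where
  "operator_norm A =
     (SUP v \<in> {v \<in> carrier_vec (dim_col A). euclidean_norm v \<le> 1}. euclidean_norm (A *\<^sub>v v))"

definition normalized_gram_matrix :: "real set list \<Rightarrow> real mat" where
  "normalized_gram_matrix Is = (1 / operator_norm (gram_matrix Is)) \<cdot>\<^sub>m gram_matrix Is"

text \<open>\<open>eigenvalue_sequence B l\<close>: the sequence \<open>l\<close> lists, in some order, the eigenvalues with
  multiplicity of the direct sum of the normalized Gram matrix and an infinite zero block, that is,
  the \<open>n\<close> eigenvalues \<open>es\<close> of the normalized Gram matrix followed by infinitely many zeros. The
  enumeration \<open>Is\<close> is immaterial, since another one conjugates the matrix by a permutation. A
  splitting of the characteristic polynomial into real linear factors exists because the Gram matrix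
  is symmetric. Sequences are indexed from 0.\<close>

definition eigenvalue_sequence :: "barcode \<Rightarrow> (nat \<Rightarrow> real) \<Rightarrow> bool" where
  "eigenvalue_sequence B l \<longleftrightarrow>
     (\<exists>Is es p. mset Is = B \<and>
        char_poly (normalized_gram_matrix Is) = (\<Prod>e\<leftarrow>es. [:- e, 1:]) \<and>
        bij p \<and>
        (\<forall>i. l (p i) = (if i < length es then es ! i else 0)))"

definition sequence_dist :: "(nat \<Rightarrow> real) \<Rightarrow> (nat \<Rightarrow> real) \<Rightarrow> real" where
  "sequence_dist l m = (INF \<sigma> \<in> {\<sigma>. bij \<sigma>}. sqrt (\<Sum>i. \<bar>l i - m (\<sigma> i)\<bar>\<^sup>2))"

text \<open>Eigenvalue sequences of a barcode differ only by a permutation of the indices, over which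
  \<^const>\<open>sequence_dist\<close> takes the infimum, so the choice below does not affect the value.\<close>

definition d_S2 :: "barcode \<Rightarrow> barcode \<Rightarrow> real" where
  "d_S2 B C = sequence_dist (SOME l. eigenvalue_sequence B l) (SOME m. eigenvalue_sequence C m)"

end

theory Submission
  imports Defs
begin

text \<open>
  The optimal matching of two decreasing sequences is the identity. Expanding the squares,
  \<open>\<Sum>i. (l i - m (\<sigma> i))\<^sup>2\<close> equals \<open>\<Sum>i. (l i)\<^sup>2\<close> plus \<open>\<Sum>i. (m i)\<^sup>2\<close> minus twice the cross term
  \<open>\<Sum>i. l i * m (\<sigma> i)\<close>, because a bijection leaves the sum of the squares of \<open>m\<close> unchanged. So
  minimizing the distance means maximizing the cross term, and the rearrangement inequality
  (\<open>rearrangement_inequality\<close>) says that the identity does this. Only finitely many terms are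
  nonzero, so there is no question of convergence. A decreasing sequence that is eventually zero is
  nonnegative, and nonnegativity of \<open>l\<close> is what makes the summation by parts in the rearrangement
  inequality work.

  That the infimum equals \<^const>\<open>d_S2\<close> is a statement of well-definedness:
  \<^const>\<open>d_S2\<close> evaluates the infimum at arbitrarily chosen eigenvalue sequences, and these must be
  compared with \<open>l\<close> and \<open>m\<close>. Two enumerations of one barcode give Gram matrices that differ by
  simultaneously permuting rows and columns. This changes neither the operator norm
  (\<open>operator_norm_relabel\<close>) nor the characteristic polynomial (\<open>char_poly_relabel\<close>), and a
  polynomial determines the multiset of its roots. Therefore any two eigenvalue sequences of a
  barcode are rearrangements of each other (\<open>eigenvalue_sequence_unique\<close>), and
  \<^const>\<open>sequence_dist\<close> is invariant under rearranging its arguments (\<open>sequence_dist_reindex\<close>).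
\<close>

section \<open>Rearrangement of finitely supported sequences\<close>

lemma suminf_bij:
  fixes f :: "nat \<Rightarrow> real"
  assumes "bij p" and fin: "finite {i. f i \<noteq> 0}"
  shows "(\<Sum>i. f (p i)) = (\<Sum>i. f i)"
proof -
  let ?N = "{i. f i \<noteq> 0}"
  have "finite (p -` ?N)"
    using assms by (intro finite_vimageI) (auto simp: bij_is_inj)
  then have "(\<Sum>i. f (p i)) = (\<Sum>i\<in>p -` ?N. f (p i))"
    by (rule suminf_finite) auto
  also have "bij_betw p (p -` ?N) ?N"
    using \<open>bij p\<close> unfolding bij_betw_def bij_def by (auto intro: inj_on_subset)
  then have "(\<Sum>i\<in>p -` ?N. f (p i)) = (\<Sum>i\<in>?N. f i)"
    by (rule sum.reindex_bij_betw)
  also have "\<dots> = (\<Sum>i. f i)"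
    by (rule suminf_finite [symmetric]) (use fin in auto)
  finally show ?thesis .
qed

lemma finite_support_bij:
  fixes f :: "nat \<Rightarrow> real"
  assumes "bij p" and "finite {i. f i \<noteq> 0}"
  shows "finite {i. f (p i) \<noteq> 0}"
  using finite_vimageI [OF assms(2) bij_is_inj [OF assms(1)]] by (simp add: vimage_def)

lemma suminf_square_diff:
  fixes f g :: "nat \<Rightarrow> real"
  assumes f: "finite {i. f i \<noteq> 0}" and g: "finite {i. g i \<noteq> 0}"
  shows "(\<Sum>i. \<bar>f i - g i\<bar>\<^sup>2) = (\<Sum>i. (f i)\<^sup>2) + (\<Sum>i. (g i)\<^sup>2) - 2 * (\<Sum>i. f i * g i)"
proof -
  let ?N = "{i. f i \<noteq> 0} \<union> {i. g i \<noteq> 0}"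
  have fin: "finite ?N"
    using f g by simp
  have "(\<Sum>i. h i) = (\<Sum>i\<in>?N. h i)"
    if "\<And>i. f i = 0 \<Longrightarrow> g i = 0 \<Longrightarrow> h i = 0" for h :: "nat \<Rightarrow> real"
    using that by (intro suminf_finite fin) auto
  note eq = this
  have "(\<Sum>i\<in>?N. \<bar>f i - g i\<bar>\<^sup>2)
      = (\<Sum>i\<in>?N. (f i)\<^sup>2) + (\<Sum>i\<in>?N. (g i)\<^sup>2) - 2 * (\<Sum>i\<in>?N. f i * g i)"
    by (simp add: power2_diff sum.distrib sum_subtractf sum_distrib_left mult.assoc)
  then show ?thesis
    by (simp add: eq)
qed

lemma decseq_finite_support_nonneg:
  fixes l :: "nat \<Rightarrow> real"
  assumes "decseq l" and "finite {i. l i \<noteq> 0}"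
  shows "l i \<ge> 0"
proof -
  obtain n where "\<forall>k\<in>{i. l i \<noteq> 0}. k < n"
    using finite_nat_set_iff_bounded assms(2) by blast
  then have "l (max i n) = 0"
    by fastforce
  moreover have "l (max i n) \<le> l i"
    using decseqD [OF assms(1)] by simp
  ultimately show ?thesis
    by simp
qed

text \<open>Removing the largest index works by induction, since a set of \<open>Suc n\<close> natural numbers has
  an element that is at least \<open>n\<close>.\<close>

lemma decseq_sum_le_initial_sum:
  fixes m :: "nat \<Rightarrow> real"
  assumes "decseq m" and "finite A" and "card A = n"
  shows "sum m A \<le> sum m {..<n}"
  using assms(2,3)
proof (induction n arbitrary: A)
  case 0
  then show ?case by simp
next
  case (Suc n)
  define a where "a = Max A"
  have a: "a \<in> A"
    using Suc.prems unfolding a_def by (intro Max_in) auto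
  have "A \<subseteq> {..a}"
    using Suc.prems by (auto simp: a_def)
  then have "n \<le> a"
    using card_mono [of "{..a}" A] Suc.prems by simp
  then have "m a \<le> m n"
    using decseqD [OF \<open>decseq m\<close>] by blast
  moreover have "sum m (A - {a}) \<le> sum m {..<n}"
    using Suc.prems a by (intro Suc.IH) auto
  moreover have "sum m A = m a + sum m (A - {a})"
    using Suc.prems a by (intro sum.remove) auto
  ultimately show ?case
    by simp
qed

text \<open>Summation by parts: the weighted sum is a combination of the partial sums of \<open>z\<close>, with the
  nonnegative coefficients \<open>l k - l (Suc k)\<close>, and \<open>l n\<close> for the last of them.\<close>

lemma decseq_weighted_sum_nonneg:
  fixes l z :: "nat \<Rightarrow> real"
  assumes "decseq l" and "\<And>i. l i \<ge> 0" and Z: "\<And>k. sum z {..<k} \<ge> 0"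
  shows "(\<Sum>i<n. l i * z i) \<ge> 0"
proof -
  \<comment> \<open>The boundary term of the summation by parts is kept, to make the induction go through.\<close>
  have "(\<Sum>i<n. l i * z i) \<ge> l n * sum z {..<n}"
  proof (induction n)
    case 0
    then show ?case by simp
  next
    case (Suc n)
    have "l (Suc n) * sum z {..<Suc n} \<le> l n * sum z {..<Suc n}"
      using decseq_SucD [OF \<open>decseq l\<close>] Z by (intro mult_right_mono)
    also have "\<dots> = l n * sum z {..<n} + l n * z n"
      by (simp add: distrib_left)
    finally show ?case
      using Suc.IH by simp
  qed
  moreover have "l n * sum z {..<n} \<ge> 0"
    using assms by simp
  ultimately show ?thesis
    by linarith
qed

text \<open>By summation by parts it suffices to compare the partial sums of \<open>m \<circ> \<sigma>\<close> and of \<open>m\<close>, and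
  the first \<open>k\<close> terms of \<open>m\<close> are its largest ones.\<close>

lemma rearrangement_inequality:
  fixes l m :: "nat \<Rightarrow> real"
  assumes "decseq l" and "decseq m" and fin: "finite {i. l i \<noteq> 0}" and "inj \<sigma>"
  shows "(\<Sum>i. l i * m (\<sigma> i)) \<le> (\<Sum>i. l i * m i)"
proof -
  obtain n where n: "\<forall>k\<in>{i. l i \<noteq> 0}. k < n"
    using finite_nat_set_iff_bounded fin by blast
  have eq: "(\<Sum>i. l i * x i) = (\<Sum>i<n. l i * x i)" for x
    using n by (intro suminf_finite) auto
  have "(\<Sum>i<n. l i * (m i - m (\<sigma> i))) \<ge> 0"
  proof (rule decseq_weighted_sum_nonneg [OF \<open>decseq l\<close>])
    show "l i \<ge> 0" for i
      using decseq_finite_support_nonneg [OF \<open>decseq l\<close> fin] .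
    fix k
    have inj: "inj_on \<sigma> {..<k}"
      using \<open>inj \<sigma>\<close> by (rule inj_on_subset) simp
    have "(\<Sum>i<k. m (\<sigma> i)) = sum m (\<sigma> ` {..<k})"
      using sum.reindex [OF inj, of m] by simp
    also have "\<dots> \<le> sum m {..<k}"
      by (rule decseq_sum_le_initial_sum) (use \<open>decseq m\<close> inj in \<open>auto simp: card_image\<close>)
    finally show "(\<Sum>i<k. m i - m (\<sigma> i)) \<ge> 0"
      by (simp add: sum_subtractf)
  qed
  then show ?thesis
    by (simp add: eq right_diff_distrib sum_subtractf)
qed

lemma sequence_dist_reindex:
  fixes l m :: "nat \<Rightarrow> real"
  assumes p: "bij p" and q: "bij q"
    and l: "finite {i. l i \<noteq> 0}" and m: "finite {i. m i \<noteq> 0}"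
  shows "sequence_dist (\<lambda>i. l (p i)) (\<lambda>i. m (q i)) = sequence_dist l m"
proof -
  define h where "h = (\<lambda>\<sigma>. q \<circ> \<sigma> \<circ> Hilbert_Choice.inv p)"
  define F where "F = (\<lambda>\<sigma>. sqrt (\<Sum>i. \<bar>l i - m (\<sigma> i)\<bar>\<^sup>2))"
  have F_h: "sqrt (\<Sum>i. \<bar>l (p i) - m (q (\<sigma> i))\<bar>\<^sup>2) = F (h \<sigma>)" if "bij \<sigma>" for \<sigma>
  proof -
    have "bij (h \<sigma>)"
      using p q that by (auto simp: h_def intro!: bij_comp bij_imp_bij_inv)
    then have "finite ({i. l i \<noteq> 0} \<union> {i. m (h \<sigma> i) \<noteq> 0})"
      using l finite_support_bij [OF _ m] by blast
    then have "finite {i. \<bar>l i - m (h \<sigma> i)\<bar>\<^sup>2 \<noteq> 0}"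
      by (rule finite_subset [rotated]) auto
    from suminf_bij [OF p this] show ?thesis
      using p by (simp add: F_def h_def bij_is_inj)
  qed
  have "h ` {\<sigma>. bij \<sigma>} = {\<sigma>. bij \<sigma>}"
  proof (intro equalityI subsetI)
    fix \<tau> assume "\<tau> \<in> h ` {\<sigma>. bij \<sigma>}"
    then show "\<tau> \<in> {\<sigma>. bij \<sigma>}"
      using p q by (auto simp: h_def intro!: bij_comp bij_imp_bij_inv)
  next
    fix \<tau> :: "nat \<Rightarrow> nat" assume "\<tau> \<in> {\<sigma>. bij \<sigma>}"
    then have "bij (Hilbert_Choice.inv q \<circ> \<tau> \<circ> p)"
      using p q by (auto intro!: bij_comp bij_imp_bij_inv)
    moreover have "\<tau> = h (Hilbert_Choice.inv q \<circ> \<tau> \<circ> p)"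
      using p q by (auto simp: h_def fun_eq_iff bij_is_surj surj_f_inv_f)
    ultimately show "\<tau> \<in> h ` {\<sigma>. bij \<sigma>}"
      by blast
  qed
  then have "F ` {\<sigma>. bij \<sigma>} = (\<lambda>\<sigma>. F (h \<sigma>)) ` {\<sigma>. bij \<sigma>}"
    by (metis image_image)
  also have "\<dots> = (\<lambda>\<sigma>. sqrt (\<Sum>i. \<bar>l (p i) - m (q (\<sigma> i))\<bar>\<^sup>2)) ` {\<sigma>. bij \<sigma>}"
    by (intro image_cong) (simp_all only: F_h mem_Collect_eq)
  finally show ?thesis
    by (simp add: sequence_dist_def F_def)
qed

section \<open>Relabelling a matrix\<close>

text \<open>For a permutation \<open>p\<close> of the indices of a square matrix, this is conjugation by its
  permutation matrix, written with indices because sums and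
  determinants can then be reindexed directly.\<close>

definition relabel_mat :: "(nat \<Rightarrow> nat) \<Rightarrow> 'a mat \<Rightarrow> 'a mat" where
  "relabel_mat p A = Matrix.mat (dim_row A) (dim_col A) (\<lambda>(i, j). A $$ (p i, p j))"

definition relabel_vec :: "(nat \<Rightarrow> nat) \<Rightarrow> 'a Matrix.vec \<Rightarrow> 'a Matrix.vec" where
  "relabel_vec p v = Matrix.vec (dim_vec v) (\<lambda>i. vec_index v (p i))"

lemma permutes_less [simp]:
  assumes "p permutes {..<n}" and "i < n"
  shows "p i < (n :: nat)"
  using permutes_in_image [OF assms(1), of i] assms(2) by simp

lemma relabel_mat_carrier [simp]: "A \<in> carrier_mat n n \<Longrightarrow> relabel_mat p A \<in> carrier_mat n n"
  by (auto simp: relabel_mat_def)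

lemma relabel_mat_smult:
  assumes "A \<in> carrier_mat n n" and "p permutes {..<n}"
  shows "relabel_mat p (c \<cdot>\<^sub>m A) = c \<cdot>\<^sub>m relabel_mat p A"
  using assms by (intro eq_matI) (auto simp: relabel_mat_def)

lemma relabel_mat_inverse:
  assumes "A \<in> carrier_mat n n" and "p permutes {..<n}"
  shows "relabel_mat (Hilbert_Choice.inv p) (relabel_mat p A) = A"
  using assms permutes_inv [OF assms(2)]
  by (intro eq_matI) (auto simp: relabel_mat_def permutes_inverses)

lemma euclidean_norm_relabel:
  assumes "p permutes {..<n}" and "v \<in> carrier_vec n"
  shows "euclidean_norm (relabel_vec p v) = euclidean_norm v"
proof -
  have "(\<Sum>i\<in>{0..<n}. vec_index v (p i) * vec_index v (p i))
      = (\<Sum>i\<in>{0..<n}. vec_index v i * vec_index v i)"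
    using sum.reindex_bij_betw [OF permutes_imp_bij [OF assms(1)],
        of "\<lambda>i. vec_index v i * vec_index v i"]
    by (simp add: atLeast0LessThan)
  then show ?thesis
    using assms by (simp add: euclidean_norm_def scalar_prod_def relabel_vec_def)
qed

lemma relabel_mat_mult_vec:
  fixes A :: "real mat"
  assumes p: "p permutes {..<n}" and A: "A \<in> carrier_mat n n" and v: "v \<in> carrier_vec n"
  shows "relabel_mat p A *\<^sub>v relabel_vec p v = relabel_vec p (A *\<^sub>v v)"
proof (rule eq_vecI)
  fix i assume "i < dim_vec (relabel_vec p (A *\<^sub>v v))"
  then have i: "i < n"
    using A by (simp add: relabel_vec_def)
  have "(\<Sum>j\<in>{0..<n}. A $$ (p i, p j) * vec_index v (p j))
      = (\<Sum>j\<in>{0..<n}. A $$ (p i, j) * vec_index v j)"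
    using sum.reindex_bij_betw [OF permutes_imp_bij [OF p],
        of "\<lambda>j. A $$ (p i, j) * vec_index v j"]
    by (simp add: atLeast0LessThan)
  then show "vec_index (relabel_mat p A *\<^sub>v relabel_vec p v) i
      = vec_index (relabel_vec p (A *\<^sub>v v)) i"
    using A v p i by (simp add: relabel_vec_def relabel_mat_def scalar_prod_def)
qed (use A in \<open>simp add: relabel_vec_def relabel_mat_def\<close>)

text \<open>Relabelling vectors is an isometry that intertwines the two matrices, so it matches the
  values over which the two suprema are taken.\<close>

lemma operator_norm_relabel:
  assumes p: "p permutes {..<n}" and A: "A \<in> carrier_mat n n"
  shows "operator_norm (relabel_mat p A) = operator_norm A"
proof -
  define ball where "ball = {v \<in> carrier_vec n. euclidean_norm v \<le> 1}"
  define vals where "vals = (\<lambda>M. (\<lambda>v. euclidean_norm (M *\<^sub>v v)) ` ball)"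
  have sub: "vals M \<subseteq> vals (relabel_mat q M)"
    if q: "q permutes {..<n}" and M: "M \<in> carrier_mat n n" for q M
  proof
    fix y assume "y \<in> vals M"
    then obtain v where v: "v \<in> carrier_vec n" "euclidean_norm v \<le> 1"
      and y: "y = euclidean_norm (M *\<^sub>v v)"
      unfolding vals_def ball_def by auto
    have "relabel_vec q v \<in> ball"
      using v euclidean_norm_relabel [OF q v(1)] by (auto simp: ball_def relabel_vec_def)
    moreover have "y = euclidean_norm (relabel_mat q M *\<^sub>v relabel_vec q v)"
      using y M v by (simp add: relabel_mat_mult_vec [OF q] euclidean_norm_relabel [OF q])
    ultimately show "y \<in> vals (relabel_mat q M)"
      unfolding vals_def by blast
  qed
  have "vals (relabel_mat p A) \<subseteq> vals A"
    using sub [OF permutes_inv [OF p] relabel_mat_carrier [OF A, of p]]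
    by (simp add: relabel_mat_inverse [OF A p])
  with sub [OF p A] have "vals (relabel_mat p A) = vals A"
    by blast
  moreover have "operator_norm M = Sup (vals M)" if "M \<in> carrier_mat n n" for M
    using that by (simp add: operator_norm_def vals_def ball_def)
  ultimately show ?thesis
    using A by simp
qed

text \<open>Permuting the rows and permuting the columns each contribute the sign of \<open>p\<close>.\<close>

lemma det_relabel:
  fixes A :: "'a :: comm_ring_1 mat"
  assumes p: "p permutes {..<n}" and A: "A \<in> carrier_mat n n"
  shows "Determinant.det (relabel_mat p A) = Determinant.det A"
proof -
  have p0: "p permutes {0..<n}"
    using p by (simp add: atLeast0LessThan)
  define R where "R = Matrix.mat n n (\<lambda>(i, j). A $$ (p i, j))"
  have R: "R \<in> carrier_mat n n"
    by (simp add: R_def)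
  have "transpose_mat (relabel_mat p A) = Matrix.mat n n (\<lambda>(i, j). transpose_mat R $$ (p i, j))"
    using A p by (intro eq_matI) (auto simp: relabel_mat_def R_def)
  then have "Determinant.det (relabel_mat p A) = signof p * Determinant.det R"
    using det_permute_rows [OF _ p0, of "transpose_mat R"]
      Determinant.det_transpose [OF R]
      Determinant.det_transpose [OF relabel_mat_carrier [OF A, of p]] R
    by simp
  also have "Determinant.det R = signof p * Determinant.det A"
    unfolding R_def by (rule det_permute_rows [OF A p0])
  finally show ?thesis
    by (simp add: sign_def split: if_splits)
qed

lemma char_poly_relabel:
  fixes A :: "'a :: comm_ring_1 mat"
  assumes p: "p permutes {..<n}" and A: "A \<in> carrier_mat n n"
  shows "char_poly (relabel_mat p A) = char_poly A"
proof -
  have "char_poly_matrix (relabel_mat p A) = relabel_mat p (char_poly_matrix A)"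
    using A p permutes_inj [OF p]
    by (intro eq_matI) (auto simp: char_poly_matrix_def relabel_mat_def inj_eq)
  then show ?thesis
    using det_relabel [OF p char_poly_matrix_closed [OF A]] by (simp add: char_poly_def)
qed

section \<open>Uniqueness of the eigenvalue sequence up to order\<close>

lemma char_poly_normalized_gram_matrix_cong:
  assumes "mset Is = mset Js"
  shows "char_poly (normalized_gram_matrix Is) = char_poly (normalized_gram_matrix Js)"
proof -
  define n where "n = length Js"
  obtain p where p: "p permutes {..<n}" and Is: "permute_list p Js = Is"
    using mset_eq_permutation [OF assms] unfolding n_def by blast
  have G: "gram_matrix Js \<in> carrier_mat n n"
    by (simp add: gram_matrix_def n_def)
  have len: "length Is = n"
    using Is by (auto simp: n_def)
  have nth: "Is ! i = Js ! p i" if "i < n" for i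
    using permute_list_nth [of p Js i] p Is that by (simp add: n_def)
  have "gram_matrix Is = relabel_mat p (gram_matrix Js)"
    using G p len by (intro eq_matI) (auto simp: gram_matrix_def relabel_mat_def nth n_def)
  then have "normalized_gram_matrix Is = relabel_mat p (normalized_gram_matrix Js)"
    using G p by (simp add: normalized_gram_matrix_def operator_norm_relabel relabel_mat_smult)
  then show ?thesis
    using G p by (simp add: char_poly_relabel [of p n] normalized_gram_matrix_def)
qed

lemma proots_prod_linear_factors:
  fixes es :: "'a :: idom list"
  shows "proots (\<Prod>e\<leftarrow>es. [:- e, 1:]) = mset es"
proof (induction es)
  case (Cons e es)
  have "(\<Prod>e\<leftarrow>es. [:- e, 1:]) \<noteq> 0"
    by (auto simp: prod_list_zero_iff)
  then have "proots ([:- e, 1:] * (\<Prod>e\<leftarrow>es. [:- e, 1:])) = {#e#} + proots (\<Prod>e\<leftarrow>es. [:- e, 1:])"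
    by (subst proots_mult) auto
  then show ?case
    by (simp add: Cons.IH)
qed simp

lemma eigenvalue_sequence_finite_support:
  assumes "eigenvalue_sequence B l"
  shows "finite {i. l i \<noteq> 0}"
proof -
  obtain es :: "real list" and p where p: "bij p"
    and l: "\<And>i. l (p i) = (if i < length es then es ! i else 0)"
    using assms unfolding eigenvalue_sequence_def by blast
  have "{i. l i \<noteq> 0} \<subseteq> p ` {..<length es}"
  proof
    fix i assume "i \<in> {i. l i \<noteq> 0}"
    moreover obtain j where "i = p j"
      using p by (metis bij_pointE)
    ultimately show "i \<in> p ` {..<length es}"
      using l [of j] by (auto split: if_splits)
  qed
  then show ?thesis
    by (rule finite_subset) simp
qed

lemma eigenvalue_sequence_unique:
  assumes "eigenvalue_sequence B l" and "eigenvalue_sequence B l'"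
  obtains q where "bij q" and "l' = (\<lambda>i. l (q i))"
proof -
  obtain Is es p where Is: "mset Is = B"
    and es: "char_poly (normalized_gram_matrix Is) = (\<Prod>e\<leftarrow>es. [:- e, 1:])"
    and p: "bij p" and l: "\<And>i. l (p i) = (if i < length es then es ! i else 0)"
    using assms(1) unfolding eigenvalue_sequence_def by blast
  obtain Is' es' p' where Is': "mset Is' = B"
    and es': "char_poly (normalized_gram_matrix Is') = (\<Prod>e\<leftarrow>es'. [:- e, 1:])"
    and p': "bij p'" and l': "\<And>i. l' (p' i) = (if i < length es' then es' ! i else 0)"
    using assms(2) unfolding eigenvalue_sequence_def by blast
  have "(\<Prod>e\<leftarrow>es'. [:- e, 1:]) = (\<Prod>e\<leftarrow>es. [:- e, 1:])"
    using char_poly_normalized_gram_matrix_cong [of Is' Is] Is Is' es es' by simp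
  then have "mset es' = mset es"
    by (metis proots_prod_linear_factors)
  then obtain r where r: "r permutes {..<length es}" and es_r: "permute_list r es = es'"
    by (rule mset_eq_permutation)
  have "l' (p' i) = l (p (r i))" for i
  proof (cases "i < length es")
    case True
    then show ?thesis
      using l l' r es_r permute_list_nth [of r es i] by auto
  next
    case False
    \<comment> \<open>The padding zeros keep their places, because \<open>r\<close> fixes every index outside the lists.\<close>
    then have "r i = i"
      using permutes_not_in [OF r] by simp
    then show ?thesis
      using False l l' es_r by auto
  qed
  then have "l' i = l ((p \<circ> r \<circ> Hilbert_Choice.inv p') i)" for i
    using p' by (metis bij_inv_eq_iff comp_apply)
  moreover have "bij (p \<circ> r \<circ> Hilbert_Choice.inv p')"
    using p p' permutes_bij [OF r] by (intro bij_comp bij_imp_bij_inv)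
  ultimately show ?thesis
    using that by blast
qed

section \<open>The distance of decreasing eigenvalue sequences\<close>

theorem proposition3p2:
  fixes B C :: barcode and l m :: "nat \<Rightarrow> real"
  assumes "finite_bounded_type B" and "finite_bounded_type C"
    and "eigenvalue_sequence B l" and "eigenvalue_sequence C m"
    and "decseq l" and "decseq m"
  shows "d_S2 B C = (INF \<sigma> \<in> {\<sigma>. bij \<sigma>}. sqrt (\<Sum>i. \<bar>l i - m (\<sigma> i)\<bar>\<^sup>2))
    \<and> (INF \<sigma> \<in> {\<sigma>. bij \<sigma>}. sqrt (\<Sum>i. \<bar>l i - m (\<sigma> i)\<bar>\<^sup>2))
         = sqrt (\<Sum>i. \<bar>l i - m i\<bar>\<^sup>2)"
proof
  have l: "finite {i. l i \<noteq> 0}" and m: "finite {i. m i \<noteq> 0}"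
    using assms eigenvalue_sequence_finite_support by blast+
  obtain p where p: "bij p" "(SOME l. eigenvalue_sequence B l) = (\<lambda>i. l (p i))"
    using eigenvalue_sequence_unique [OF assms(3) someI [of "eigenvalue_sequence B", OF assms(3)]]
    by blast
  obtain q where q: "bij q" "(SOME m. eigenvalue_sequence C m) = (\<lambda>i. m (q i))"
    using eigenvalue_sequence_unique [OF assms(4) someI [of "eigenvalue_sequence C", OF assms(4)]]
    by blast
  have "d_S2 B C = sequence_dist l m"
    unfolding d_S2_def p(2) q(2) by (rule sequence_dist_reindex [OF p(1) q(1) l m])
  then show "d_S2 B C = (INF \<sigma> \<in> {\<sigma>. bij \<sigma>}. sqrt (\<Sum>i. \<bar>l i - m (\<sigma> i)\<bar>\<^sup>2))"
    by (simp add: sequence_dist_def)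
  have "sqrt (\<Sum>i. \<bar>l i - m i\<bar>\<^sup>2) \<le> sqrt (\<Sum>i. \<bar>l i - m (\<sigma> i)\<bar>\<^sup>2)" if \<sigma>: "bij \<sigma>" for \<sigma>
  proof -
    have "finite {i. (m i)\<^sup>2 \<noteq> 0}"
      using m by simp
    then have "(\<Sum>i. (m (\<sigma> i))\<^sup>2) = (\<Sum>i. (m i)\<^sup>2)"
      using suminf_bij [OF \<sigma>, of "\<lambda>i. (m i)\<^sup>2"] by simp
    moreover have "(\<Sum>i. l i * m (\<sigma> i)) \<le> (\<Sum>i. l i * m i)"
      using assms(5,6) l bij_is_inj [OF \<sigma>] by (rule rearrangement_inequality)
    ultimately have "(\<Sum>i. \<bar>l i - m i\<bar>\<^sup>2) \<le> (\<Sum>i. \<bar>l i - m (\<sigma> i)\<bar>\<^sup>2)"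
      unfolding suminf_square_diff [OF l m]
        suminf_square_diff [OF l finite_support_bij [OF \<sigma> m]]
      by linarith
    then show ?thesis
      by (rule real_sqrt_le_mono)
  qed
  moreover have "sqrt (\<Sum>i. \<bar>l i - m i\<bar>\<^sup>2)
      \<in> (\<lambda>\<sigma>. sqrt (\<Sum>i. \<bar>l i - m (\<sigma> i)\<bar>\<^sup>2)) ` {\<sigma>. bij \<sigma>}"
    by (rule image_eqI [of _ _ id]) auto
  ultimately show "(INF \<sigma> \<in> {\<sigma>. bij \<sigma>}. sqrt (\<Sum>i. \<bar>l i - m (\<sigma> i)\<bar>\<^sup>2))
      = sqrt (\<Sum>i. \<bar>l i - m i\<bar>\<^sup>2)"
    by (intro cInf_eq_minimum) auto
qed

end
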